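(* Let $SQ_n$ denote the $n$-dimensional spined cube. The following hold. (1) $SQ_3$ is vertex-transitive and is a Cayley graph of the cyclic group $\mathbb{Z}_8$. (2) $SQ_4$ is a bi-Cayley graph of the elementary abelian group $\mathbb{Z}_2^3$, and is not vertex-transitive. (3) $SQ_5$ is a bi-Cayley graph of a non-abelian group $\mathbb{Z}_2^3\rtimes \mathbb{Z}_2$ (of order $16$), and is not vertex-transitive.
   Context: All graphs are finite, simple and undirected. The spined cube $SQ_n$ ($n\ge 1$) has as vertices the $2^n$ binary strings $x_1x_2\cdots x_n$ and is defined recursively. $SQ_1$ is the complete graph on the two vertices $0$ and $1$. For $n\ge 2$, $SQ_n$ consists of two copies $0SQ_{n-1}$ and $1SQ_{n-1}$ of $SQ_{n-1}$ (every vertex label prefixed by $0$, respectively by $1$), together with the edges joining each vertex $x=0x_2\cdots x_n$ of $0SQ_{n-1}$ to exactly one vertex $x'$ of $1SQ_{n-1}$, where (all sums of bits are modulo 2): $x'=1x_2$ if $n=2$; $x'=1(x_2+x_n)x_3\cdots x_n$ if $n=3$ or $4$; $x'=1(x_2+x_{n-1})(x_3+x_n)x_4\cdots x_n$ if $n\ge 5$. A graph is vertex-transitive if its automorphism group acts transitively on its vertex set. A group of automorphisms is semiregular if no non-identity element fixes a vertex. A graph $\Gamma$ is an $m$-Cayley graph of a group $G$ if $\mathrm{Aut}(\Gamma)$ has a semiregular subgroup isomorphic to $G$ with exactly $m$ orbits on the vertex set. A Cayley graph is a $1$-Cayley graph and a bi-Cayley graph is a $2$-Cayley graph. *)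

theory Defs
  imports
    "HOL-Algebra.Group_Action"
    "HOL-Algebra.Elementary_Groups"
    "HOL-Library.Z2"
begin

section \<open>Finite simple graphs and their automorphism groups\<close>

record 'a graph =
  verts :: "'a set"
  edges :: "'a set set"

definition simple_graph :: "'a graph \<Rightarrow> bool" where
  "simple_graph \<Gamma> \<longleftrightarrow> finite (verts \<Gamma>) \<and> (\<forall>e\<in>edges \<Gamma>. e \<subseteq> verts \<Gamma> \<and> card e = 2)"

text \<open>As in \<^const>\<open>BijGroup\<close>, automorphisms are extensional functions, so that two of them are
  equal iff they agree on the vertex set.\<close>

definition graph_automorphisms :: "'a graph \<Rightarrow> ('a \<Rightarrow> 'a) set" where
  "graph_automorphisms \<Gamma> =
     {f \<in> Bij (verts \<Gamma>). \<forall>u\<in>verts \<Gamma>. \<forall>v\<in>verts \<Gamma>. {u, v} \<in> edges \<Gamma> \<longleftrightarrow> {f u, f v} \<in> edges \<Gamma>}"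

definition graph_Aut :: "'a graph \<Rightarrow> ('a \<Rightarrow> 'a) monoid" where
  "graph_Aut \<Gamma> = (BijGroup (verts \<Gamma>)) \<lparr>carrier := graph_automorphisms \<Gamma>\<rparr>"

definition vertex_transitive :: "'a graph \<Rightarrow> bool" where
  "vertex_transitive \<Gamma> \<longleftrightarrow>
     (\<forall>u\<in>verts \<Gamma>. \<forall>v\<in>verts \<Gamma>. \<exists>f\<in>carrier (graph_Aut \<Gamma>). f u = v)"

definition semiregular :: "'a graph \<Rightarrow> ('a \<Rightarrow> 'a) set \<Rightarrow> bool" where
  "semiregular \<Gamma> H \<longleftrightarrow> (\<forall>h\<in>H. h \<noteq> \<one>\<^bsub>graph_Aut \<Gamma>\<^esub> \<longrightarrow> (\<forall>v\<in>verts \<Gamma>. h v \<noteq> v))"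

definition m_Cayley_graph :: "nat \<Rightarrow> 'a graph \<Rightarrow> 'b monoid \<Rightarrow> bool" where
  "m_Cayley_graph m \<Gamma> G \<longleftrightarrow>
     (\<exists>H. subgroup H (graph_Aut \<Gamma>) \<and> semiregular \<Gamma> H \<and>
          (graph_Aut \<Gamma>)\<lparr>carrier := H\<rparr> \<cong> G \<and>
          card (orbits ((graph_Aut \<Gamma>)\<lparr>carrier := H\<rparr>) (verts \<Gamma>) (\<lambda>h. h)) = m)"

abbreviation Cayley_graph :: "'a graph \<Rightarrow> 'b monoid \<Rightarrow> bool" where
  "Cayley_graph \<equiv> m_Cayley_graph 1"

abbreviation bi_Cayley_graph :: "'a graph \<Rightarrow> 'b monoid \<Rightarrow> bool" where
  "bi_Cayley_graph \<equiv> m_Cayley_graph 2"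


section \<open>Spined cubes\<close>

text \<open>A binary string $x_1 x_2 \ldots x_n$ is the list \<open>[x\<^sub>1, x\<^sub>2, \<dots>, x\<^sub>n]\<close> over the two-element
  field \<^typ>\<open>bit\<close>.  List indexing starts at 0, so $x_i$ is \<open>x ! (i - 1)\<close>.
  \<open>spine_partner n x\<close> is the vertex $x'$ joined to $x = 0 x_2 \ldots x_n$; it is only
  used for \<open>n \<ge> 2\<close>.\<close>

definition spine_partner :: "nat \<Rightarrow> bit list \<Rightarrow> bit list" where
  "spine_partner n x =
     (if n = 2 then [1, x ! 1]
      else if n = 3 \<or> n = 4 then 1 # (x ! 1 + x ! (n - 1)) # drop 2 x
      else 1 # (x ! 1 + x ! (n - 2)) # (x ! 2 + x ! (n - 1)) # drop 3 x)"

text \<open>The value at \<open>0\<close> is a dummy: spined cubes are defined for dimension at least 1.\<close>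

fun spined_cube :: "nat \<Rightarrow> bit list graph" where
  "spined_cube 0 = \<lparr>verts = {[]}, edges = {}\<rparr>"
| "spined_cube (Suc 0) = \<lparr>verts = {[0], [1]}, edges = {{[0], [1]}}\<rparr>"
| "spined_cube (Suc (Suc k)) =
     (let n = Suc (Suc k); V = verts (spined_cube (Suc k)); E = edges (spined_cube (Suc k))
      in \<lparr>verts = (#) 0 ` V \<union> (#) 1 ` V,
          edges = {(#) 0 ` e | e. e \<in> E} \<union> {(#) 1 ` e | e. e \<in> E}
                  \<union> {{0 # u, spine_partner n (0 # u)} | u. u \<in> V}\<rparr>)"

lemma verts_spined_cube: "verts (spined_cube n) = {x. length x = n}"
proof (induction n rule: spined_cube.induct)
  case 2
  show ?case
  proof (rule Set.set_eqI)
    fix x :: "bit list"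
    show "x \<in> verts (spined_cube (Suc 0)) \<longleftrightarrow> x \<in> {x. length x = Suc 0}"
      using bit.exhaust by (fastforce simp: length_Suc_conv)
  qed
next
  case (3 k)
  have "{x :: bit list. length x = Suc (Suc k)}
        = (#) 0 ` {x. length x = Suc k} \<union> (#) 1 ` {x. length x = Suc k}" (is "?A = ?B")
  proof
    show "?A \<subseteq> ?B"
    proof
      fix x :: "bit list"
      assume "x \<in> ?A"
      then obtain b y where x: "x = b # y" "length y = Suc k"
        by (auto simp: length_Suc_conv)
      show "x \<in> ?B"
        by (rule bit.exhaust[of b]) (use x in blast)+
    qed
  qed auto
  moreover have "verts (spined_cube (Suc (Suc k)))
      = (#) 0 ` verts (spined_cube (Suc k)) \<union> (#) 1 ` verts (spined_cube (Suc k))"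
    by (simp add: Let_def)
  ultimately show ?case
    by (simp only: 3)
qed simp

lemma simple_graph_spined_cube: "simple_graph (spined_cube n)"
proof (induction n rule: spined_cube.induct)
  case (3 k)
  let ?V = "verts (spined_cube (Suc k))" and ?E = "edges (spined_cube (Suc k))"
  let ?x = "\<lambda>u. spine_partner (Suc (Suc k)) (0 # u)"
  have IH: "finite ?V" "\<And>e. e \<in> ?E \<Longrightarrow> e \<subseteq> ?V \<and> card e = 2"
    using 3 unfolding simple_graph_def by blast+
  have V: "?V = {x. length x = Suc k}" "verts (spined_cube (Suc (Suc k))) = {x. length x = Suc (Suc k)}"
    by (rule verts_spined_cube)+
  have partner: "hd (?x u) = 1 \<and> length (?x u) = Suc (Suc k)" if "length u = Suc k" for u
    using that unfolding spine_partner_def by simp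
  have new: "{0 # u, ?x u} \<subseteq> {x. length x = Suc (Suc k)} \<and> card {0 # u, ?x u} = 2"
    if "u \<in> ?V" for u
  proof -
    have u: "length u = Suc k"
      using that V by blast
    have "0 # u \<noteq> ?x u"
      using partner[OF u] by (metis list.sel(1) zero_neq_one)
    then show ?thesis
      using partner[OF u] u by (metis (mono_tags, lifting) card_2_iff empty_subsetI insert_subset length_Cons mem_Collect_eq)
  qed
  have old: "(#) b ` e \<subseteq> {x. length x = Suc (Suc k)} \<and> card ((#) b ` e) = 2"
    if "e \<in> ?E" for b e
  proof -
    have "card ((#) b ` e) = card e"
      by (simp add: card_image)
    then show ?thesis
      using IH(2)[OF that] V(1) by auto
  qed
  have fin: "finite (verts (spined_cube (Suc (Suc k))))"
    using IH(1) by (simp add: Let_def)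
  have edges: "edges (spined_cube (Suc (Suc k)))
        = {(#) 0 ` e | e. e \<in> ?E} \<union> {(#) 1 ` e | e. e \<in> ?E} \<union> {{0 # u, ?x u} | u. u \<in> ?V}"
    by (simp add: Let_def)
  have "e \<subseteq> {x. length x = Suc (Suc k)} \<and> card e = 2"
    if "e \<in> edges (spined_cube (Suc (Suc k)))" for e
  proof -
    from that consider "e \<in> {(#) 0 ` e | e. e \<in> ?E}" | "e \<in> {(#) 1 ` e | e. e \<in> ?E}"
      | "e \<in> {{0 # u, ?x u} | u. u \<in> ?V}"
      unfolding edges by (elim UnE)
    then show ?thesis
    proof cases
      case 3
      then obtain u where "u \<in> ?V" "e = {0 # u, ?x u}"
        by (elim CollectE exE conjE)
      then show ?thesis
        by (simp only: new)
    qed (elim CollectE exE conjE, simp only: old)+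
  qed
  then show ?case
    unfolding simple_graph_def V(2)[symmetric] using fin by blast
qed (auto simp: simple_graph_def)


section \<open>Semidirect products\<close>

text \<open>The external semidirect product of \<open>N\<close> by \<open>K\<close> with respect to an action
  \<open>\<theta> \<in> hom K (AutoGroup N)\<close>.\<close>

definition semidirect_product ::
  "'a monoid \<Rightarrow> 'b monoid \<Rightarrow> ('b \<Rightarrow> 'a \<Rightarrow> 'a) \<Rightarrow> ('a \<times> 'b) monoid" where
  "semidirect_product N K \<theta> =
     \<lparr>carrier = carrier N \<times> carrier K,
      mult = (\<lambda>(a, k) (b, l). (a \<otimes>\<^bsub>N\<^esub> \<theta> k b, k \<otimes>\<^bsub>K\<^esub> l)),
      one = (\<one>\<^bsub>N\<^esub>, \<one>\<^bsub>K\<^esub>)\<rparr>"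

abbreviation Z2_cubed :: "(int \<times> int \<times> int) monoid" where
  "Z2_cubed \<equiv> integer_mod_group 2 \<times>\<times> integer_mod_group 2 \<times>\<times> integer_mod_group 2"

end

theory Submission
  imports Defs
begin

text \<open>
  Unfolding the recursion, the neighbours of a vertex \<open>x\<close> are obtained by adding a vector over the
  two-element field to \<open>x\<close>, one vector for each dimension: with \<open>e\<^sub>i\<close> the \<open>i\<close>-th unit vector, these
  \<^emph>\<open>steps\<close> are
    \<^item> \<open>e\<^sub>3, e\<^sub>2, e\<^sub>1 + x\<^sub>3 e\<^sub>2\<close> in dimension 3,
    \<^item> \<open>e\<^sub>4, e\<^sub>3, e\<^sub>2 + x\<^sub>4 e\<^sub>3, e\<^sub>1 + x\<^sub>4 e\<^sub>2\<close> in dimension 4,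
    \<^item> \<open>e\<^sub>5, e\<^sub>4, e\<^sub>3 + x\<^sub>5 e\<^sub>4, e\<^sub>2 + x\<^sub>5 e\<^sub>3, e\<^sub>1 + x\<^sub>4 e\<^sub>2 + x\<^sub>5 e\<^sub>3\<close> in dimension 5.

  The steps at \<open>x\<close> depend only on \<open>x\<^sub>4\<close> in dimension 4 and only on \<open>x\<^sub>4, x\<^sub>5\<close> in dimension 5, so
  translations along \<open>e\<^sub>1, e\<^sub>2, e\<^sub>3\<close> are automorphisms of both graphs.  In dimension 4 they already form
  the required group.  In dimension 5 the transvection \<open>e\<^sub>1 \<mapsto> e\<^sub>1 + e\<^sub>2\<close> exchanges the steps at
  \<open>x\<^sub>4 = 0\<close> with those at \<open>x\<^sub>4 = 1\<close>; followed by the translation by \<open>e\<^sub>4\<close> it is an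
  involutory automorphism which normalises, but does not centralise, the group of translations.
  In dimension 3 the graph is an 8-cycle with its antipodal pairs joined (a Moebius ladder), and the
  cyclic group rotates that cycle.  All three actions are free, so the number of orbits is the
  number of vertices divided by the order of the group; this is
  \<open>m_Cayley_graph_if_free_action\<close>, whose orbit count is Burnside's lemma.

  Vertex-transitivity in dimension 3 follows because there is a single orbit.  In dimensions 4
  and 5 it fails because an automorphism preserves the number of closed walks of each length
  (\<open>walks_automorphism\<close>), and vertices with different last bits have different numbers of closed
  walks: of length 5 in dimension 4, and of length 4 in dimension 5.
\<close>

section \<open>Free actions and multi-Cayley graphs\<close>

lemma graph_Aut_group: "group (graph_Aut \<Gamma>)"
proof -
  let ?V = "verts \<Gamma>"
  interpret B: group "BijGroup ?V"
    by (rule group_BijGroup)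
  have "subgroup (graph_automorphisms \<Gamma>) (BijGroup ?V)"
  proof (rule B.subgroupI)
    show "graph_automorphisms \<Gamma> \<subseteq> carrier (BijGroup ?V)"
      by (auto simp: graph_automorphisms_def BijGroup_def)
    show "graph_automorphisms \<Gamma> \<noteq> {}"
      using id_Bij[of ?V] by (auto simp: graph_automorphisms_def)
  next
    fix f assume f: "f \<in> graph_automorphisms \<Gamma>"
    then have "f \<in> Bij ?V"
      by (simp add: graph_automorphisms_def)
    then have img: "f ` ?V = ?V"
      by (simp add: Bij_def bij_betw_def)
    have "{inv_into ?V f u, inv_into ?V f v} \<in> edges \<Gamma> \<longleftrightarrow> {u, v} \<in> edges \<Gamma>"
      if "u \<in> ?V" "v \<in> ?V" for u v
      using f that img inv_into_into[of u f ?V] inv_into_into[of v f ?V]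
        f_inv_into_f[of u f ?V] f_inv_into_f[of v f ?V]
      by (simp add: graph_automorphisms_def)
    then show "inv\<^bsub>BijGroup ?V\<^esub> f \<in> graph_automorphisms \<Gamma>"
      using \<open>f \<in> Bij ?V\<close> by (simp add: graph_automorphisms_def inv_BijGroup restrict_inv_into_Bij)
  next
    fix f g assume fg: "f \<in> graph_automorphisms \<Gamma>" "g \<in> graph_automorphisms \<Gamma>"
    then have "g v \<in> ?V" if "v \<in> ?V" for v
      using that Bij_imp_funcset by (fastforce simp: graph_automorphisms_def)
    then show "f \<otimes>\<^bsub>BijGroup ?V\<^esub> g \<in> graph_automorphisms \<Gamma>"
      using fg by (simp add: graph_automorphisms_def BijGroup_def compose_Bij compose_eq)
  qed
  then show ?thesis
    unfolding graph_Aut_def by (rule B.subgroup_imp_group)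
qed

text \<open>
  Since only the identity has fixed points, Burnside's lemma reduces to
  \<open>|orbits| * |G| = |V|\<close>, so that no orbit has to be computed.  Preservation of edges is demanded
  in one direction only, because the inverse group element supplies the other.  The action is by
  total functions, which are restricted to the vertices to obtain elements of \<^term>\<open>graph_Aut \<Gamma>\<close>.
\<close>

lemma m_Cayley_graph_if_free_action:
  fixes \<Gamma> :: "'a graph" and G :: "'g monoid" and act :: "'g \<Rightarrow> 'a \<Rightarrow> 'a"
  assumes "group G"
    and fin: "finite (verts \<Gamma>)" and nonempty: "verts \<Gamma> \<noteq> {}"
    and closed: "\<And>g v. g \<in> carrier G \<Longrightarrow> v \<in> verts \<Gamma> \<Longrightarrow> act g v \<in> verts \<Gamma>"
    and one: "\<And>v. v \<in> verts \<Gamma> \<Longrightarrow> act \<one>\<^bsub>G\<^esub> v = v"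
    and mult: "\<And>g h v. g \<in> carrier G \<Longrightarrow> h \<in> carrier G \<Longrightarrow> v \<in> verts \<Gamma> \<Longrightarrow>
                 act (g \<otimes>\<^bsub>G\<^esub> h) v = act g (act h v)"
    and edge: "\<And>g u v. g \<in> carrier G \<Longrightarrow> u \<in> verts \<Gamma> \<Longrightarrow> v \<in> verts \<Gamma> \<Longrightarrow>
                 {u, v} \<in> edges \<Gamma> \<Longrightarrow> {act g u, act g v} \<in> edges \<Gamma>"
    and free: "\<And>g v. g \<in> carrier G \<Longrightarrow> v \<in> verts \<Gamma> \<Longrightarrow> act g v = v \<Longrightarrow> g = \<one>\<^bsub>G\<^esub>"
    and card: "card (verts \<Gamma>) = m * order G"
  shows "m_Cayley_graph m \<Gamma> G"
proof -
  interpret G: group G by fact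
  let ?V = "verts \<Gamma>"
  let ?A = "graph_Aut \<Gamma>"
  define \<phi> where "\<phi> g = restrict (act g) ?V" for g
  have inv: "act (inv\<^bsub>G\<^esub> g) (act g v) = v \<and> act g (act (inv\<^bsub>G\<^esub> g) v) = v"
    if "g \<in> carrier G" "v \<in> ?V" for g v
    using that mult[of "inv\<^bsub>G\<^esub> g" g v] mult[of g "inv\<^bsub>G\<^esub> g" v] one[of v] by simp
  have bij: "\<phi> g \<in> Bij ?V" if g: "g \<in> carrier G" for g
  proof -
    have "bij_betw (act g) ?V ?V"
      using g inv closed
      by (intro bij_betwI[where g = "act (inv\<^bsub>G\<^esub> g)"]) auto
    then show ?thesis
      by (simp add: \<phi>_def Bij_def)
  qed
  have aut: "\<phi> g \<in> graph_automorphisms \<Gamma>" if g: "g \<in> carrier G" for g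
  proof -
    have "{u, v} \<in> edges \<Gamma>" if "u \<in> ?V" "v \<in> ?V" "{act g u, act g v} \<in> edges \<Gamma>" for u v
      using edge[of "inv\<^bsub>G\<^esub> g" "act g u" "act g v"] that g inv closed by simp
    then show ?thesis
      using bij[OF g] edge[OF g] by (auto simp: graph_automorphisms_def \<phi>_def)
  qed
  have \<phi>_mult: "\<phi> (g \<otimes>\<^bsub>G\<^esub> h) = compose ?V (\<phi> g) (\<phi> h)"
    if "g \<in> carrier G" "h \<in> carrier G" for g h
    using that mult closed by (auto simp: \<phi>_def compose_def fun_eq_iff)
  have hom: "\<phi> \<in> hom G (BijGroup ?V)"
    using bij \<phi>_mult by (auto simp: hom_def BijGroup_def)
  have hom_A: "\<phi> \<in> hom G ?A"
    using aut bij \<phi>_mult by (auto simp: hom_def BijGroup_def graph_Aut_def)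
  interpret A: group ?A
    by (rule graph_Aut_group)
  interpret \<phi>: group_hom G ?A \<phi>
    by (intro group_hom.intro group_hom_axioms.intro G.is_group A.is_group hom_A)
  interpret act: group_action G ?V \<phi>
    by (intro group_action.intro group_hom.intro group_hom_axioms.intro G.is_group group_BijGroup hom)
  define H where "H = \<phi> ` carrier G"
  have fixes_one: "g = \<one>\<^bsub>G\<^esub>" if "g \<in> carrier G" "v \<in> ?V" "\<phi> g v = v" for g v
    using free[OF that(1,2)] that(2,3) by (simp add: \<phi>_def)
  have inj: "inj_on \<phi> (carrier G)"
  proof (rule inj_onI)
    fix g h assume gh: "g \<in> carrier G" "h \<in> carrier G" "\<phi> g = \<phi> h"
    obtain v where v: "v \<in> ?V"
      using nonempty by blast
    have "act g v = act h v"
      using gh(3) v by (metis \<phi>_def restrict_apply')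
    \<comment> \<open>Two group elements that agree at a single vertex differ by an element with a fixed point.\<close>
    then have "act (inv\<^bsub>G\<^esub> h \<otimes>\<^bsub>G\<^esub> g) v = v"
      using gh v mult inv by simp
    then have "inv\<^bsub>G\<^esub> h \<otimes>\<^bsub>G\<^esub> g = \<one>\<^bsub>G\<^esub>"
      using free gh v by blast
    then show "g = h"
      using gh by (metis G.inv_equality G.inv_inv G.inv_closed)
  qed
  have "subgroup H ?A"
    unfolding H_def by (rule \<phi>.img_is_subgroup)
  moreover have "semiregular \<Gamma> H"
    unfolding semiregular_def H_def using fixes_one \<phi>.hom_one by blast
  moreover have "?A\<lparr>carrier := H\<rparr> \<cong> G"
  proof -
    have "\<phi> \<in> iso G (?A\<lparr>carrier := H\<rparr>)"
      using hom_A inj by (auto simp: iso_def hom_def H_def bij_betw_def)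
    then show ?thesis
      using G.iso_sym is_isoI by blast
  qed
  moreover have "card (orbits (?A\<lparr>carrier := H\<rparr>) ?V (\<lambda>h. h)) = m"
  proof -
    have "orbits (?A\<lparr>carrier := H\<rparr>) ?V (\<lambda>h. h) = orbits G ?V \<phi>"
    proof -
      have "orbit (?A\<lparr>carrier := H\<rparr>) (\<lambda>h. h) x = orbit G \<phi> x" for x
        by (auto simp: orbit_def H_def)
      then show ?thesis
        by (simp add: orbits_def)
    qed
    moreover have order_pos: "order G > 0"
      using card nonempty fin by (metis card_gt_0_iff mult_is_0 neq0_conv)
    then have fin_G: "finite (carrier G)"
      by (simp add: G.order_gt_0_iff_finite)
    have "invariants ?V \<phi> g = (if g = \<one>\<^bsub>G\<^esub> then ?V else {})" if "g \<in> carrier G" for g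
    proof (cases "g = \<one>\<^bsub>G\<^esub>")
      case True
      then show ?thesis
        using one by (simp add: invariants_def \<phi>_def)
    next
      case False
      then show ?thesis
        using fixes_one[OF that] by (auto simp: invariants_def)
    qed
    then have "(\<Sum>g\<in>carrier G. card (invariants ?V \<phi> g)) = (\<Sum>g\<in>carrier G. if g = \<one>\<^bsub>G\<^esub> then card ?V else 0)"
      by (intro sum.cong) auto
    then have "card (orbits G ?V \<phi>) * order G = card ?V"
      using act.burnside[OF fin_G fin] fin_G by simp
    ultimately show ?thesis
      using card order_pos by simp
  qed
  ultimately show ?thesis
    unfolding m_Cayley_graph_def by blast
qed

lemma Cayley_graph_vertex_transitive:
  assumes "Cayley_graph \<Gamma> G"
  shows "vertex_transitive \<Gamma>"
  unfolding vertex_transitive_def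
proof (intro ballI)
  fix u v assume uv: "u \<in> verts \<Gamma>" "v \<in> verts \<Gamma>"
  from assms obtain H where H: "subgroup H (graph_Aut \<Gamma>)"
    and "card (orbits ((graph_Aut \<Gamma>)\<lparr>carrier := H\<rparr>) (verts \<Gamma>) (\<lambda>h. h)) = 1"
    unfolding m_Cayley_graph_def by blast
  then obtain O1 where orbs: "orbits ((graph_Aut \<Gamma>)\<lparr>carrier := H\<rparr>) (verts \<Gamma>) (\<lambda>h. h) = {O1}"
    by (auto simp: card_1_singleton_iff)
  have "(\<lambda>h. h x) ` H = O1" if "x \<in> verts \<Gamma>" for x
  proof -
    have "orbit ((graph_Aut \<Gamma>)\<lparr>carrier := H\<rparr>) (\<lambda>h. h) x \<in> {O1}"
      unfolding orbs[symmetric] orbits_def using that by blast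
    then show ?thesis
      by (simp add: orbit_def image_def Bex_def conj_commute)
  qed
  then have "(\<lambda>h. h u) ` H = (\<lambda>h. h v) ` H"
    using uv by simp
  moreover have "v \<in> (\<lambda>h. h v) ` H"
    using subgroup.one_closed[OF H] uv
    by (intro image_eqI[of _ _ "\<one>\<^bsub>graph_Aut \<Gamma>\<^esub>"]) (simp_all add: graph_Aut_def BijGroup_def)
  ultimately have "v \<in> (\<lambda>h. h u) ` H"
    by simp
  then obtain h where "h \<in> H" "h u = v"
    by blast
  then show "\<exists>f\<in>carrier (graph_Aut \<Gamma>). f u = v"
    using subgroup.subset[OF H] by (intro bexI[of _ h]) auto
qed

section \<open>Neighbours in spined cubes\<close>

text \<open>
  What a spine edge does to the bits behind the one that it flips.  The recursion describes such an
  edge from its end in the 0-copy; the map is an involution, so the same rule applies from the other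
  end.
\<close>

definition spine_shift :: "bit list \<Rightarrow> bit list" where
  "spine_shift u = tl (spine_partner (Suc (length u)) (0 # u))"

fun neighbours :: "bit list \<Rightarrow> bit list list" where
  "neighbours [] = []"
| "neighbours [b] = [[b + 1]]"
| "neighbours (b # c # u) = ((b + 1) # spine_shift (c # u)) # map ((#) b) (neighbours (c # u))"

lemma spine_shift_simps [simp]:
  "spine_shift [a] = [a]"
  "spine_shift [a, b] = [a + b, b]"
  "spine_shift [a, b, c] = [a + c, b, c]"
  "spine_shift (a # b # c # d # u) = (a + (c # d # u) ! length u) # (b + last (d # u)) # c # d # u"
  by (auto simp: spine_shift_def spine_partner_def last_conv_nth nth_Cons')

lemma length_spine_shift [simp]: "u \<noteq> [] \<Longrightarrow> length (spine_shift u) = length u"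
  by (cases u) (auto simp: spine_shift_def spine_partner_def)

lemma spine_shift_involution [simp]:
  assumes "u \<noteq> []"
  shows "spine_shift (spine_shift u) = u"
proof -
  from assms consider a where "u = [a]" | a b where "u = [a, b]" | a b c where "u = [a, b, c]"
    | a b c d w where "u = a # b # c # d # w"
    by (metis neq_Nil_conv)
  then show ?thesis
    by cases (auto simp: add.assoc simp del: add_bit_eq_xor)
qed

text \<open>
  The two copies contribute the edges between words with equal first bit.  A spine edge with first
  bits 1 and 0 is the reversal of one with first bits 0 and 1, and \<open>spine_shift_involution\<close> makes
  both conditions the same.
\<close>

lemma edges_spined_cube_Cons:
  assumes "u \<noteq> []" "length u = length v"
  shows "{b # u, c # v} \<in> edges (spined_cube (Suc (length u))) \<longleftrightarrow>
           (if b = c then {u, v} \<in> edges (spined_cube (length u)) else v = spine_shift u)"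
proof -
  obtain k where k: "length u = Suc k"
    using assms(1) by (cases u) auto
  have partner: "spine_partner (Suc (Suc k)) (0 # w) = 1 # spine_shift w" if "length w = Suc k" for w
    using that by (auto simp: spine_shift_def spine_partner_def)
  let ?E = "edges (spined_cube (Suc k))"
  have V: "verts (spined_cube (Suc k)) = {w. length w = Suc k}"
    by (rule verts_spined_cube)
  have old: "{b # u, c # v} \<in> {(#) a ` e | e. e \<in> ?E} \<longleftrightarrow> b = a \<and> c = a \<and> {u, v} \<in> ?E" for a
  proof
    assume "{b # u, c # v} \<in> {(#) a ` e | e. e \<in> ?E}"
    then obtain e where e: "e \<in> ?E" "{b # u, c # v} = (#) a ` e"
      by blast
    then have "b = a" "c = a"
      by (auto simp: set_eq_iff)
    moreover have "inj ((#) a)"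
      by simp
    moreover have "(#) a ` {u, v} = (#) a ` e"
      using e calculation by simp
    ultimately have "{u, v} = e" "b = a" "c = a"
      by (blast dest: inj_image_eq_iff[THEN iffD1])+
    then show "b = a \<and> c = a \<and> {u, v} \<in> ?E"
      using e by simp
  next
    assume "b = a \<and> c = a \<and> {u, v} \<in> ?E"
    then show "{b # u, c # v} \<in> {(#) a ` e | e. e \<in> ?E}"
      by (auto intro!: exI[of _ "{u, v}"])
  qed
  have new: "{b # u, c # v} \<in> {{0 # w, spine_partner (Suc (Suc k)) (0 # w)} | w. w \<in> verts (spined_cube (Suc k))}
        \<longleftrightarrow> b \<noteq> c \<and> v = spine_shift u"
  proof -
    have "{b # u, c # v} \<in> {{0 # w, spine_partner (Suc (Suc k)) (0 # w)} | w. w \<in> verts (spined_cube (Suc k))}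
        \<longleftrightarrow> (\<exists>w. length w = Suc k \<and> {b # u, c # v} = {0 # w, 1 # spine_shift w})"
      unfolding V by (auto simp: partner) (metis partner)
    also have "\<dots> \<longleftrightarrow> b = 0 \<and> c = 1 \<and> v = spine_shift u \<or> b = 1 \<and> c = 0 \<and> u = spine_shift v"
      using assms k by (auto simp: doubleton_eq_iff)
    also have "u = spine_shift v \<longleftrightarrow> v = spine_shift u"
      using assms spine_shift_involution by (metis length_0_conv)
    finally show ?thesis
      by (cases b; cases c) auto
  qed
  have "edges (spined_cube (Suc (Suc k))) = {(#) 0 ` e | e. e \<in> ?E} \<union> {(#) 1 ` e | e. e \<in> ?E}
      \<union> {{0 # w, spine_partner (Suc (Suc k)) (0 # w)} | w. w \<in> verts (spined_cube (Suc k))}"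
    by (simp add: Let_def)
  then show ?thesis
    unfolding k by (simp only: Un_iff old new) (cases b; cases c; simp)
qed

lemma edges_spined_cube_iff_neighbours:
  "{x, y} \<in> edges (spined_cube (length x)) \<longleftrightarrow> y \<in> set (neighbours x)"
proof (induction x arbitrary: y rule: neighbours.induct)
  case (2 b)
  show ?case
    by (cases b) (auto simp: doubleton_eq_iff)
next
  case (3 b c u)
  let ?w = "c # u"
  have len: "length y = Suc (length ?w)" if "{b # ?w, y} \<in> edges (spined_cube (length (b # ?w)))"
  proof -
    have "y \<in> verts (spined_cube (length (b # ?w)))"
      using that simple_graph_spined_cube unfolding simple_graph_def by blast
    then show ?thesis
      unfolding verts_spined_cube by simp
  qed
  have length_neighbours: "length z = length ?w" if "z \<in> set (neighbours ?w)" for z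
  proof -
    have "z \<in> verts (spined_cube (length ?w))"
      using that 3 simple_graph_spined_cube unfolding simple_graph_def by blast
    then show ?thesis
      unfolding verts_spined_cube by simp
  qed
  show ?case
  proof (cases "length y = Suc (length ?w)")
    case True
    then obtain d v where y: "y = d # v" "length v = length ?w"
      by (cases y) auto
    have "d = b + 1 \<longleftrightarrow> b \<noteq> d"
      by (cases b; cases d) auto
    then show ?thesis
      using edges_spined_cube_Cons[of ?w v b d] y 3[of v] by auto
  next
    case False
    then have "y \<notin> set (neighbours (b # ?w))"
      using length_neighbours by (auto simp del: neighbours.simps simp: neighbours.simps(3))
    then show ?thesis
      using len False by blast
  qed
qed simp

lemma length_neighbours: "y \<in> set (neighbours x) \<Longrightarrow> length y = length x"
  using simple_graph_spined_cube[of "length x"] verts_spined_cube[of "length x"]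
  unfolding simple_graph_def edges_spined_cube_iff_neighbours[symmetric] by blast

lemma distinct_neighbours: "distinct (neighbours x)"
  by (induction x rule: neighbours.induct) (auto simp: distinct_map)

text \<open>
  Phrased with the dimension as a parameter of its own, so that the two facts rewrite goals about
  \<^term>\<open>spined_cube 5\<close> and words of five explicit bits.
\<close>

lemma spined_cube_membership:
  "length x = n \<Longrightarrow> x \<in> verts (spined_cube n)"
  "length x = n \<Longrightarrow> {x, y} \<in> edges (spined_cube n) \<longleftrightarrow> y \<in> set (neighbours x)"
  using verts_spined_cube edges_spined_cube_iff_neighbours by auto

lemma finite_verts_spined_cube: "finite (verts (spined_cube n))"
  using simple_graph_spined_cube by (simp add: simple_graph_def)

lemma verts_spined_cube_nonempty: "verts (spined_cube n) \<noteq> {}"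
  unfolding verts_spined_cube by (auto intro: exI[of _ "replicate n 0"])

lemma card_verts_spined_cube: "card (verts (spined_cube n)) = 2 ^ n"
proof -
  have UNIV: "(UNIV :: bit set) = {0, 1}"
    using bit.exhaust by blast
  then have "card {x :: bit list. set x \<subseteq> UNIV \<and> length x = n} = card (UNIV :: bit set) ^ n"
    by (intro card_lists_length_eq) (simp only: UNIV finite.intros)
  moreover have "card (UNIV :: bit set) = 2"
    unfolding UNIV by simp
  ultimately show ?thesis
    unfolding verts_spined_cube by simp
qed

lemma length_3_cases:
  assumes "length x = 3"
  obtains a b c where "x = [a, b, c]"
  using assms by (auto simp: length_Suc_conv numeral_3_eq_3)

lemma length_4_cases:
  assumes "length x = 4"
  obtains a b c d where "x = [a, b, c, d]"
  using assms by (auto simp: length_Suc_conv eval_nat_numeral)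

lemma length_5_cases:
  assumes "length x = 5"
  obtains a b c d e where "x = [a, b, c, d, e]"
  using assms by (auto simp: length_Suc_conv eval_nat_numeral)

section \<open>Closed walks as an obstruction to vertex-transitivity\<close>

fun walks :: "'a graph \<Rightarrow> nat \<Rightarrow> 'a \<Rightarrow> 'a \<Rightarrow> nat" where
  "walks \<Gamma> 0 u v = of_bool (u = v)"
| "walks \<Gamma> (Suc k) u v = (\<Sum>w | w \<in> verts \<Gamma> \<and> {u, w} \<in> edges \<Gamma>. walks \<Gamma> k w v)"

text \<open>
  An automorphism maps the neighbours of \<open>u\<close> bijectively to those of \<open>f u\<close>, so it permutes the summands
  of the recursion.
\<close>

lemma walks_automorphism:
  assumes f: "f \<in> graph_automorphisms \<Gamma>" and "u \<in> verts \<Gamma>" "v \<in> verts \<Gamma>"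
  shows "walks \<Gamma> k (f u) (f v) = walks \<Gamma> k u v"
proof -
  have bij: "bij_betw f (verts \<Gamma>) (verts \<Gamma>)"
    using f by (simp add: graph_automorphisms_def Bij_def)
  show ?thesis
    using assms(2)
  proof (induction k arbitrary: u)
    case 0
    then show ?case
      using bij assms(3) by (auto simp: bij_betw_def inj_on_def)
  next
    case (Suc k)
    have "bij_betw f {w. w \<in> verts \<Gamma> \<and> {u, w} \<in> edges \<Gamma>} {w. w \<in> verts \<Gamma> \<and> {f u, w} \<in> edges \<Gamma>}"
      unfolding bij_betw_def
    proof (intro conjI subset_antisym subsetI)
      show "inj_on f {w. w \<in> verts \<Gamma> \<and> {u, w} \<in> edges \<Gamma>}"
        using bij by (auto simp: bij_betw_def inj_on_def)
    next
      fix x assume x: "x \<in> {w. w \<in> verts \<Gamma> \<and> {f u, w} \<in> edges \<Gamma>}"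
      then obtain w where "w \<in> verts \<Gamma>" "x = f w"
        using bij by (auto simp: bij_betw_def)
      then show "x \<in> f ` {w. w \<in> verts \<Gamma> \<and> {u, w} \<in> edges \<Gamma>}"
        using x f Suc.prems by (auto simp: graph_automorphisms_def)
    qed (use bij f Suc.prems in \<open>auto simp: bij_betw_def graph_automorphisms_def\<close>)
    then have "walks \<Gamma> (Suc k) (f u) (f v)
        = (\<Sum>w | w \<in> verts \<Gamma> \<and> {u, w} \<in> edges \<Gamma>. walks \<Gamma> k (f w) (f v))"
      using sum.reindex_bij_betw[of f _ _ "\<lambda>w. walks \<Gamma> k w (f v)"] by simp
    then show ?case
      using Suc.IH by simp
  qed
qed

lemma not_vertex_transitive_if_closed_walks_differ:
  assumes "u \<in> verts \<Gamma>" "v \<in> verts \<Gamma>" "walks \<Gamma> k u u \<noteq> walks \<Gamma> k v v"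
  shows "\<not> vertex_transitive \<Gamma>"
proof
  assume "vertex_transitive \<Gamma>"
  then obtain f where "f \<in> graph_automorphisms \<Gamma>" "f u = v"
    using assms(1,2) by (auto simp: vertex_transitive_def graph_Aut_def)
  then show False
    using walks_automorphism[of f \<Gamma> u u k] assms by simp
qed

text \<open>
  The executable form of \<^const>\<open>walks\<close> on spined cubes: it sums over the list of neighbours rather than
  over a set given by a condition.
\<close>

fun walk_count :: "nat \<Rightarrow> bit list \<Rightarrow> bit list \<Rightarrow> nat" where
  "walk_count 0 x y = of_bool (x = y)"
| "walk_count (Suc k) x y = (\<Sum>z\<leftarrow>neighbours x. walk_count k z y)"

lemma walks_spined_cube:
  assumes "length x = n"
  shows "walks (spined_cube n) k x y = walk_count k x y"
  using assms
proof (induction k arbitrary: x)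
  case (Suc k)
  have "{z \<in> verts (spined_cube n). {x, z} \<in> edges (spined_cube n)} = set (neighbours x)"
    using Suc.prems length_neighbours by (auto simp: spined_cube_membership verts_spined_cube)
  then have "walks (spined_cube n) (Suc k) x y
      = (\<Sum>z\<in>set (neighbours x). walks (spined_cube n) k z y)"
    by simp
  also have "\<dots> = (\<Sum>z\<in>set (neighbours x). walk_count k z y)"
    using Suc length_neighbours by (intro sum.cong refl) metis
  finally show ?case
    by (simp add: distinct_neighbours sum_list_distinct_conv_sum_set)
qed simp

section \<open>Semidirect products\<close>

lemma semidirect_product_simps [simp]:
  "carrier (semidirect_product N K \<theta>) = carrier N \<times> carrier K"
  "\<one>\<^bsub>semidirect_product N K \<theta>\<^esub> = (\<one>\<^bsub>N\<^esub>, \<one>\<^bsub>K\<^esub>)"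
  "(a, k) \<otimes>\<^bsub>semidirect_product N K \<theta>\<^esub> (b, l) = (a \<otimes>\<^bsub>N\<^esub> \<theta> k b, k \<otimes>\<^bsub>K\<^esub> l)"
  by (simp_all add: semidirect_product_def)

lemma semidirect_product_group:
  assumes "group N" "group K" and \<theta>: "\<theta> \<in> hom K (AutoGroup N)"
  shows "group (semidirect_product N K \<theta>)"
proof -
  interpret N: group N by fact
  interpret K: group K by fact
  interpret \<theta>: group_hom K "AutoGroup N" \<theta>
    by (intro group_hom.intro group_hom_axioms.intro K.is_group N.AutoGroup \<theta>)
  have auto: "\<theta> k \<in> auto N" if "k \<in> carrier K" for k
    using \<theta>.hom_closed[OF that] by (simp add: AutoGroup_def)
  have closed: "\<theta> k a \<in> carrier N" if "k \<in> carrier K" "a \<in> carrier N" for k a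
    using auto[OF that(1)] that(2) by (auto simp: auto_def hom_def)
  have distrib: "\<theta> k (a \<otimes>\<^bsub>N\<^esub> b) = \<theta> k a \<otimes>\<^bsub>N\<^esub> \<theta> k b"
    if "k \<in> carrier K" "a \<in> carrier N" "b \<in> carrier N" for k a b
    using auto[OF that(1)] that(2,3) by (auto simp: auto_def hom_def)
  have comp: "\<theta> (k \<otimes>\<^bsub>K\<^esub> l) a = \<theta> k (\<theta> l a)"
    if "k \<in> carrier K" "l \<in> carrier K" "a \<in> carrier N" for k l a
    using \<theta>.hom_mult[OF that(1,2)] auto[OF that(1)] auto[OF that(2)] that(3)
    by (simp add: AutoGroup_def BijGroup_def auto_def compose_eq)
  have id: "\<theta> \<one>\<^bsub>K\<^esub> a = a" if "a \<in> carrier N" for a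
    using \<theta>.hom_one that by (simp add: AutoGroup_def BijGroup_def)
  have "\<theta> k \<one>\<^bsub>N\<^esub> = \<one>\<^bsub>N\<^esub>" if "k \<in> carrier K" for k
    using distrib[OF that, of "\<one>\<^bsub>N\<^esub>" "\<one>\<^bsub>N\<^esub>"] closed[OF that, of "\<one>\<^bsub>N\<^esub>"] by simp
  then have inv: "\<theta> (inv\<^bsub>K\<^esub> k) (inv\<^bsub>N\<^esub> a) \<otimes>\<^bsub>N\<^esub> \<theta> (inv\<^bsub>K\<^esub> k) a = \<one>\<^bsub>N\<^esub>"
    if "k \<in> carrier K" "a \<in> carrier N" for k a
    using distrib[of "inv\<^bsub>K\<^esub> k" "inv\<^bsub>N\<^esub> a" a] that
    by (metis K.inv_closed N.inv_closed N.l_inv)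
  show ?thesis
  proof (rule groupI)
    fix x assume "x \<in> carrier (semidirect_product N K \<theta>)"
    then obtain a k where x: "x = (a, k)" "a \<in> carrier N" "k \<in> carrier K"
      by auto
    show "\<exists>y\<in>carrier (semidirect_product N K \<theta>).
        y \<otimes>\<^bsub>semidirect_product N K \<theta>\<^esub> x = \<one>\<^bsub>semidirect_product N K \<theta>\<^esub>"
      by (rule bexI[of _ "(\<theta> (inv\<^bsub>K\<^esub> k) (inv\<^bsub>N\<^esub> a), inv\<^bsub>K\<^esub> k)"])
        (use x inv closed in \<open>auto simp del: \<theta>.hom_inv\<close>)
  qed (auto simp: closed distrib comp id N.m_assoc K.m_assoc simp del: \<theta>.hom_mult \<theta>.hom_one)
qed

section \<open>Arithmetic modulo two\<close>

text \<open>
  By default the simplifier turns addition of bits into exclusive or and then into statements about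
  parities.  Removing those rules and cancelling equal summands instead keeps symbolic words in the
  language of linear algebra, which avoids case distinctions on every bit.
\<close>

lemma bit_add_self [simp]: "a + a = 0" "a + (a + b) = b" for a b :: bit
  by (cases a; cases b; simp)+

lemma of_int_bit_eq_of_bool_odd: "(of_int n :: bit) = of_bool (odd n)"
proof -
  have "(of_int n :: bit) = of_int (2 * (n div 2) + n mod 2)"
    by simp
  also have "\<dots> = of_int (n mod 2)"
    unfolding of_int_add of_int_mult by simp
  also have "\<dots> = of_bool (odd n)"
    by (cases "odd n") (simp_all add: odd_iff_mod_2_eq_one)
  finally show ?thesis .
qed

lemma of_int_bit_mod_2 [simp]: "(of_int (n mod 2) :: bit) = of_int n"
  by (simp add: of_int_bit_eq_of_bool_odd)

lemma of_int_bit_eq_0_iff: "n \<in> {0..<2} \<Longrightarrow> (of_int n :: bit) = 0 \<longleftrightarrow> n = 0"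
  by (auto simp: of_int_bit_eq_of_bool_odd)

text \<open>
  Rewriting with this equivalence reduces identities between sums and products modulo 2 to
  propositional logic about parities.
\<close>

lemma mod_2_eq_iff_even: "m mod 2 = n mod 2 \<longleftrightarrow> (even m \<longleftrightarrow> even n)" for m n :: int
  by presburger

lemma group_Z2_cubed: "group Z2_cubed"
  by (intro DirProd_group group_integer_mod_group)

lemma order_Z2_cubed: "order Z2_cubed = 8"
  by (simp add: order_def carrier_integer_mod_group card_cartesian_product)

section \<open>A non-abelian group of order sixteen\<close>

text \<open>
  The transvection \<open>e\<^sub>1 \<mapsto> e\<^sub>1 + e\<^sub>2\<close> to the power \<open>k\<close>, restricted to the carrier because elements of
  \<^const>\<open>AutoGroup\<close> are extensional.  The semidirect product that it defines is the direct product of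
  a dihedral group of order 8, generated by \<open>e\<^sub>1\<close> and the new involution, with the group
  of order 2 generated by \<open>e\<^sub>3\<close>.
\<close>

definition twist :: "int \<Rightarrow> int \<times> int \<times> int \<Rightarrow> int \<times> int \<times> int" where
  "twist k = (\<lambda>(p, q, r)\<in>carrier Z2_cubed. (p, (q + k * p) mod 2, r))"

lemma twist_apply [simp]:
  assumes "(p, q, r) \<in> carrier Z2_cubed"
  shows "twist k (p, q, r) = (p, (q + k * p) mod 2, r)"
  using assms by (simp add: twist_def)

lemma twist_closed: "t \<in> carrier Z2_cubed \<Longrightarrow> twist k t \<in> carrier Z2_cubed"
  by (cases t) (auto simp: twist_def carrier_integer_mod_group)

lemma twist_twist:
  assumes "t \<in> carrier Z2_cubed"
  shows "twist k (twist l t) = twist ((k + l) mod 2) t"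
proof -
  obtain p q r where t: "t = (p, q, r)"
    by (cases t)
  have "((q + l * p) mod 2 + k * p) mod 2 = (q + (k + l) mod 2 * p) mod 2"
    by (auto simp: mod_2_eq_iff_even)
  then show ?thesis
    using assms twist_closed[OF assms, of l] unfolding t by (simp add: twist_def)
qed

lemma twist_auto: "twist k \<in> auto Z2_cubed"
proof -
  have "twist k \<in> hom Z2_cubed Z2_cubed"
  proof (rule homI)
    fix s t assume "s \<in> carrier Z2_cubed" "t \<in> carrier Z2_cubed"
    moreover have "((q + q') mod 2 + k * ((p + p') mod 2)) mod 2
        = ((q + k * p) mod 2 + (q' + k * p') mod 2) mod 2" for p q p' q' :: int
      by (auto simp: mod_2_eq_iff_even)
    ultimately show "twist k (s \<otimes>\<^bsub>Z2_cubed\<^esub> t) = twist k s \<otimes>\<^bsub>Z2_cubed\<^esub> twist k t"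
      by (auto simp: twist_def carrier_integer_mod_group)
  qed (rule twist_closed)
  moreover have "bij_betw (twist k) (carrier Z2_cubed) (carrier Z2_cubed)"
  proof (rule bij_betwI[where g = "twist k"])
    fix t assume t: "t \<in> carrier Z2_cubed"
    then show "twist k (twist k t) = t"
      unfolding twist_twist[OF t] by (auto simp: twist_def carrier_integer_mod_group)
    then show "twist k (twist k t) = t" .
  qed (auto simp: twist_closed simp del: carrier_DirProd)
  ultimately show ?thesis
    by (simp add: auto_def Bij_def twist_def)
qed

lemma twist_hom: "twist \<in> hom (integer_mod_group 2) (AutoGroup Z2_cubed)"
proof (rule homI)
  fix k l :: int
  have "twist ((k + l) mod 2) = compose (carrier Z2_cubed) (twist k) (twist l)"
  proof (rule extensionalityI)
    show "twist ((k + l) mod 2) \<in> extensional (carrier Z2_cubed)"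
      by (simp add: twist_def)
  qed (simp_all add: compose_eq twist_twist del: carrier_DirProd)
  then show "twist (k \<otimes>\<^bsub>integer_mod_group 2\<^esub> l) = twist k \<otimes>\<^bsub>AutoGroup Z2_cubed\<^esub> twist l"
    using twist_auto by (simp add: AutoGroup_def BijGroup_def auto_def)
qed (simp add: AutoGroup_def twist_auto)

abbreviation twisted_group :: "((int \<times> int \<times> int) \<times> int) monoid" where
  "twisted_group \<equiv> semidirect_product Z2_cubed (integer_mod_group 2) twist"

lemma group_twisted_group: "group twisted_group"
  using semidirect_product_group[OF group_Z2_cubed group_integer_mod_group twist_hom] .

lemma order_twisted_group: "order twisted_group = 16"
  by (simp add: order_def carrier_integer_mod_group card_cartesian_product)

lemma not_comm_twisted_group: "\<not> comm_group twisted_group"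
proof
  assume "comm_group twisted_group"
  then interpret comm_group twisted_group .
  \<comment> \<open>The involution moves \<open>e\<^sub>1\<close> to \<open>e\<^sub>1 + e\<^sub>2\<close>, hence does not commute with it.\<close>
  have "((1, 0, 0), 0) \<otimes>\<^bsub>twisted_group\<^esub> ((0, 0, 0), 1) = ((0, 0, 0), 1) \<otimes>\<^bsub>twisted_group\<^esub> ((1, 0, 0), 0)"
    by (rule m_comm) (auto simp: carrier_integer_mod_group)
  then show False
    by (simp add: twist_def carrier_integer_mod_group)
qed

section \<open>Dimension three\<close>

text \<open>
  One step along the 8-cycle 000, 001, 111, 110, 010, 011, 101, 100, whose antipodal pairs are
  the edges that flip the middle bit.  The cycle flips \<open>x\<^sub>3\<close> where \<open>x\<^sub>1 = x\<^sub>3\<close> and otherwise uses the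
  edge that flips \<open>x\<^sub>1\<close>; the formula is the polynomial form of this rule.
\<close>

definition spiral :: "bit list \<Rightarrow> bit list" where
  "spiral x = [x ! 2, x ! 1 + x ! 2 * (x ! 0 + 1), x ! 0 + 1]"

lemma spiral_Cons [simp]: "spiral [a, b, c] = [c, b + c * (a + 1), a + 1]"
  by (simp add: spiral_def)

lemma spiral_neighbours:
  assumes "length x = 3" "y \<in> set (neighbours x)"
  shows "spiral y \<in> set (neighbours (spiral x))"
proof -
  obtain a b c where "x = [a, b, c]"
    using assms(1) by (rule length_3_cases)
  then show ?thesis
    using assms(2) by (cases a; cases b; cases c; auto)
qed

lemma length_spiral_funpow: "length x = 3 \<Longrightarrow> length ((spiral ^^ k) x) = 3"
  by (induction k) (simp_all add: spiral_def)

lemma spiral_funpow_fixes_iff: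
  assumes "length x = 3"
  shows "(spiral ^^ k) x = x \<longleftrightarrow> 8 dvd k"
proof -
  obtain a b c where x: "x = [a, b, c]"
    using assms by (rule length_3_cases)
  have "(spiral ^^ 8) x = x"
    unfolding x by (cases a; cases b; cases c; simp add: eval_nat_numeral)
  then have "(spiral ^^ k) x = (spiral ^^ (k mod 8)) x"
    by (simp add: funpow_mod_eq)
  \<comment> \<open>The eight powers move \<open>x\<close> through all eight vertices.\<close>
  moreover have "(spiral ^^ j) x \<noteq> x" if "j \<in> {1, 2, 3, 4, 5, 6, 7}" for j
    using that unfolding x by (cases a; cases b; cases c; auto simp: eval_nat_numeral)
  moreover have "k mod 8 = 0 \<or> k mod 8 \<in> {1, 2, 3, 4, 5, 6, 7}"
    by auto
  ultimately show ?thesis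
    by (metis dvd_eq_mod_eq_0 funpow_0)
qed

lemma Cayley_spined_cube_3: "Cayley_graph (spined_cube 3) (integer_mod_group 8)"
proof (rule m_Cayley_graph_if_free_action[where act = "\<lambda>k. spiral ^^ nat k"])
  fix k l u v
  assume k: "k \<in> carrier (integer_mod_group 8)" and u: "u \<in> verts (spined_cube 3)"
  then have u3: "length u = 3"
    by (simp add: verts_spined_cube)
  show "(spiral ^^ nat k) u \<in> verts (spined_cube 3)"
    using u3 length_spiral_funpow by (simp add: verts_spined_cube)
  show "k = \<one>\<^bsub>integer_mod_group 8\<^esub>" if "(spiral ^^ nat k) u = u"
    using spiral_funpow_fixes_iff[OF u3, of "nat k"] that k
    by (auto simp: carrier_integer_mod_group dest: dvd_imp_le)
  show "{(spiral ^^ nat k) u, (spiral ^^ nat k) v} \<in> edges (spined_cube 3)"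
    if "{u, v} \<in> edges (spined_cube 3)"
  proof -
    have "(spiral ^^ j) v \<in> set (neighbours ((spiral ^^ j) u))" for j
      using that u3 length_spiral_funpow
      by (induction j) (simp_all add: spined_cube_membership spiral_neighbours del: neighbours.simps)
    then show ?thesis
      using u3 length_spiral_funpow by (simp add: spined_cube_membership)
  qed
  show "(spiral ^^ nat (k \<otimes>\<^bsub>integer_mod_group 8\<^esub> l)) u = (spiral ^^ nat k) ((spiral ^^ nat l) u)"
    if l: "l \<in> carrier (integer_mod_group 8)"
  proof -
    have "nat ((k + l) mod 8) = (nat k + nat l) mod 8"
      using k l by (simp add: carrier_integer_mod_group nat_mod_distrib nat_add_distrib)
    moreover have "(spiral ^^ 8) u = u"
      using spiral_funpow_fixes_iff[OF u3] by simp
    ultimately show ?thesis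
      by (simp add: funpow_mod_eq funpow_add)
  qed
qed (simp_all add: card_verts_spined_cube finite_verts_spined_cube verts_spined_cube_nonempty
      order_def carrier_integer_mod_group)

section \<open>Dimension four\<close>

definition translate4 :: "int \<times> int \<times> int \<Rightarrow> bit list \<Rightarrow> bit list" where
  "translate4 = (\<lambda>(p, q, r) x. [x ! 0 + of_int p, x ! 1 + of_int q, x ! 2 + of_int r, x ! 3])"

lemma translate4_Cons [simp]:
  "translate4 (p, q, r) [a, b, c, d] = [a + of_int p, b + of_int q, c + of_int r, d]"
  by (simp add: translate4_def)

lemma bi_Cayley_spined_cube_4: "bi_Cayley_graph (spined_cube 4) Z2_cubed"
proof (rule m_Cayley_graph_if_free_action[where act = translate4])
  fix g u v
  assume "g \<in> carrier Z2_cubed" and u: "u \<in> verts (spined_cube 4)" and "{u, v} \<in> edges (spined_cube 4)"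
  moreover obtain p q r where "g = (p, q, r)"
    by (cases g)
  moreover obtain a b c d where "u = [a, b, c, d]"
    using u unfolding verts_spined_cube by (blast elim: length_4_cases)
  ultimately show "{translate4 g u, translate4 g v} \<in> edges (spined_cube 4)"
    by (auto simp: spined_cube_membership ac_simps simp del: add_bit_eq_xor mult_bit_eq_and)
qed (auto simp: group_Z2_cubed order_Z2_cubed card_verts_spined_cube finite_verts_spined_cube
     verts_spined_cube_nonempty, auto simp: verts_spined_cube carrier_integer_mod_group of_int_bit_eq_0_iff
   elim!: length_4_cases simp del: add_bit_eq_xor mult_bit_eq_and)

text \<open>
  The steps are \<open>e\<^sub>4, e\<^sub>3, e\<^sub>2, e\<^sub>1\<close> where \<open>x\<^sub>4 = 0\<close> and \<open>e\<^sub>4, e\<^sub>3, e\<^sub>2 + e\<^sub>3, e\<^sub>1 + e\<^sub>2\<close> where \<open>x\<^sub>4 = 1\<close>.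
  A closed walk of length 5 uses \<open>e\<^sub>4\<close> exactly twice, and its other three steps sum to zero.  There
  are three ways to choose these: \<open>e\<^sub>2, e\<^sub>3\<close> at \<open>x\<^sub>4 = 0\<close> with \<open>e\<^sub>2 + e\<^sub>3\<close> at \<open>x\<^sub>4 = 1\<close>; \<open>e\<^sub>1, e\<^sub>2\<close> at \<open>x\<^sub>4 = 0\<close>
  with \<open>e\<^sub>1 + e\<^sub>2\<close> at \<open>x\<^sub>4 = 1\<close>; and \<open>e\<^sub>2\<close> at \<open>x\<^sub>4 = 0\<close> with \<open>e\<^sub>3, e\<^sub>2 + e\<^sub>3\<close> at \<open>x\<^sub>4 = 1\<close>.  The part of
  the walk on the other side of the starting point is contiguous, while the part on its own side
  may be split between the beginning and the end.  If two steps are on the starting side, a choice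
  can be arranged in six ways, and if one is, in four.  From \<open>x\<^sub>4 = 0\<close> this gives
  \<open>2 * 6 + 4 = 16\<close> walks, from \<open>x\<^sub>4 = 1\<close> it gives \<open>2 * 4 + 6 = 14\<close>.
\<close>

lemma not_vertex_transitive_spined_cube_4: "\<not> vertex_transitive (spined_cube 4)"
proof (rule not_vertex_transitive_if_closed_walks_differ)
  have "walk_count 5 [0, 0, 0, 0] [0, 0, 0, 0] = 16"
    by code_simp
  moreover have "walk_count 5 [0, 0, 0, 1] [0, 0, 0, 1] = 14"
    by code_simp
  ultimately show "walks (spined_cube 4) 5 [0, 0, 0, 0] [0, 0, 0, 0]
      \<noteq> walks (spined_cube 4) 5 [0, 0, 0, 1] [0, 0, 0, 1]"
    by (simp add: walks_spined_cube)
qed (simp_all add: spined_cube_membership)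

section \<open>Dimension five\<close>

text \<open>
  The affine map \<open>x \<mapsto> A\<^sup>k x + p e\<^sub>1 + q e\<^sub>2 + r e\<^sub>3 + k e\<^sub>4\<close>, where \<open>A\<close> is the transvection
  \<open>e\<^sub>1 \<mapsto> e\<^sub>1 + e\<^sub>2\<close>.  Composing two such maps yields the multiplication of the semidirect product.
\<close>

definition twisted_translate5 :: "(int \<times> int \<times> int) \<times> int \<Rightarrow> bit list \<Rightarrow> bit list" where
  "twisted_translate5 = (\<lambda>((p, q, r), k) x.
     [x ! 0 + of_int p, x ! 1 + of_int k * x ! 0 + of_int q, x ! 2 + of_int r, x ! 3 + of_int k, x ! 4])"

lemma twisted_translate5_Cons [simp]:
  "twisted_translate5 ((p, q, r), k) [a, b, c, d, e] =
     [a + of_int p, b + of_int k * a + of_int q, c + of_int r, d + of_int k, e]"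
  by (simp add: twisted_translate5_def)

lemma bi_Cayley_spined_cube_5: "bi_Cayley_graph (spined_cube 5) twisted_group"
proof (rule m_Cayley_graph_if_free_action[where act = twisted_translate5])
  fix g h u v
  assume g: "g \<in> carrier twisted_group" and u: "u \<in> verts (spined_cube 5)"
  obtain p q r k where g_eq: "g = ((p, q, r), k)"
    by (metis prod.collapse)
  obtain a b c d e where u_eq: "u = [a, b, c, d, e]"
    using u unfolding verts_spined_cube by (blast elim: length_5_cases)
  show "twisted_translate5 g u \<in> verts (spined_cube 5)"
    unfolding g_eq u_eq verts_spined_cube by simp
  show "g = \<one>\<^bsub>twisted_group\<^esub>" if "twisted_translate5 g u = u"
  proof -
    \<comment> \<open>The fourth bit shows that \<open>k = 0\<close>; then the map is a translation and the first three bits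
      determine the rest.\<close>
    have k: "k = 0"
      using that g unfolding g_eq u_eq
      by (simp add: carrier_integer_mod_group of_int_bit_eq_0_iff del: add_bit_eq_xor mult_bit_eq_and)
    then show ?thesis
      using that g unfolding g_eq u_eq
      by (simp add: carrier_integer_mod_group of_int_bit_eq_0_iff del: add_bit_eq_xor mult_bit_eq_and)
  qed
  show "{twisted_translate5 g u, twisted_translate5 g v} \<in> edges (spined_cube 5)"
    if "{u, v} \<in> edges (spined_cube 5)"
    using that unfolding g_eq u_eq
    by (auto simp: spined_cube_membership algebra_simps simp del: add_bit_eq_xor mult_bit_eq_and)
  show "twisted_translate5 (g \<otimes>\<^bsub>twisted_group\<^esub> h) u = twisted_translate5 g (twisted_translate5 h u)"
    if "h \<in> carrier twisted_group"
  proof -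
    obtain p' q' r' k' where h: "h = ((p', q', r'), k')"
      by (metis prod.collapse)
    show ?thesis
      using that g unfolding g_eq u_eq h
      by (simp add: algebra_simps del: add_bit_eq_xor mult_bit_eq_and)
  qed
qed (auto simp: group_twisted_group order_twisted_group card_verts_spined_cube finite_verts_spined_cube
     verts_spined_cube_nonempty, auto simp: verts_spined_cube elim!: length_5_cases)

text \<open>
  Every vertex has 45 closed walks of length 4 which retrace their steps, and two more for each
  4-cycle through it.  A step can be combined into a 4-cycle with \<open>e\<^sub>4\<close> or \<open>e\<^sub>5\<close> only if it is available
  on both sides of that edge.  This excludes all partners of \<open>e\<^sub>5\<close> except \<open>e\<^sub>4\<close>, and it excludes the pair
  of \<open>e\<^sub>4\<close> with the step that flips \<open>x\<^sub>1\<close>.  Where \<open>x\<^sub>5 = 1\<close>, the step \<open>e\<^sub>3 + e\<^sub>4\<close> also changes \<open>x\<^sub>4\<close>, and its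
  pair with the step that flips \<open>x\<^sub>1\<close> is lost as well.  Of the ten pairs of steps, six remain
  where \<open>x\<^sub>5 = 0\<close> and five where \<open>x\<^sub>5 = 1\<close>.
\<close>

lemma not_vertex_transitive_spined_cube_5: "\<not> vertex_transitive (spined_cube 5)"
proof (rule not_vertex_transitive_if_closed_walks_differ)
  have "walk_count 4 [0, 0, 0, 0, 0] [0, 0, 0, 0, 0] = 57"
    by code_simp
  moreover have "walk_count 4 [0, 0, 0, 0, 1] [0, 0, 0, 0, 1] = 55"
    by code_simp
  ultimately show "walks (spined_cube 5) 4 [0, 0, 0, 0, 0] [0, 0, 0, 0, 0]
      \<noteq> walks (spined_cube 5) 4 [0, 0, 0, 0, 1] [0, 0, 0, 0, 1]"
    by (simp add: walks_spined_cube)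
qed (simp_all add: spined_cube_membership)

section \<open>The spined cubes of dimensions three, four and five\<close>

theorem lemma3p2:
  shows "(vertex_transitive (spined_cube 3) \<and>
          Cayley_graph (spined_cube 3) (integer_mod_group 8)) \<and>
         (bi_Cayley_graph (spined_cube 4) Z2_cubed \<and>
          \<not> vertex_transitive (spined_cube 4)) \<and>
         ((\<exists>\<theta> \<in> hom (integer_mod_group 2) (AutoGroup Z2_cubed).
             group (semidirect_product Z2_cubed (integer_mod_group 2) \<theta>) \<and>
             \<not> comm_group (semidirect_product Z2_cubed (integer_mod_group 2) \<theta>) \<and>
             order (semidirect_product Z2_cubed (integer_mod_group 2) \<theta>) = 16 \<and>
             bi_Cayley_graph (spined_cube 5)
               (semidirect_product Z2_cubed (integer_mod_group 2) \<theta>)) \<and>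
          \<not> vertex_transitive (spined_cube 5))"
  using Cayley_spined_cube_3 Cayley_graph_vertex_transitive[OF Cayley_spined_cube_3]
    bi_Cayley_spined_cube_4 not_vertex_transitive_spined_cube_4
    twist_hom group_twisted_group not_comm_twisted_group order_twisted_group
    bi_Cayley_spined_cube_5 not_vertex_transitive_spined_cube_5
  by blast

end
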